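(* Let $m,r>0$, let $\mathbb{I}=\mathrm{diag}(I_1,I_2,I_3)$ with $I_1,I_2,I_3>0$, let $E$ be the $3\times 3$ identity matrix, and on $\mathbb{R}^3\times\mathbb{R}^3\ni(\gamma,K)$ set $\Omega=(\mathbb{I}+mr^2E)^{-1}K$. The characteristic distribution of the almost Poisson bracket on $\mathbb{R}^3\times\mathbb{R}^3$ $$\{f,g\}_{\mathrm{Rank}3}=-(K+mr^2\Omega)\cdot\left(\frac{\partial f}{\partial K}\times\frac{\partial g}{\partial K}\right)-\gamma\cdot\left(\frac{\partial f}{\partial K}\times\frac{\partial g}{\partial\gamma}-\frac{\partial g}{\partial K}\times\frac{\partial f}{\partial\gamma}\right)$$ is not integrable.
   Context: An almost Poisson bracket is a skew-symmetric bilinear bracket on smooth functions satisfying the Leibniz rule (not necessarily the Jacobi identity). The (almost) Hamiltonian vector field of $f$ is $X_f$ with $X_f(g)=\{g,f\}$. The characteristic distribution is the (possibly singular) distribution whose fibers are spanned by the (almost) Hamiltonian vector fields. It is integrable if through every point passes an immersed submanifold whose tangent spaces are the fibers of the distribution; in particular the Lie bracket of two vector fields with values in an integrable distribution again has values in it. *)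

theory Defs
  imports "HOL-Analysis.Analysis"
begin

subsection \<open>Smooth maps between Euclidean spaces\<close>

text \<open>Meant for open \<open>S\<close> only. As the dimension is finite, requiring all directional derivatives
  \<open>x \<mapsto> Df(x) v\<close> to be \<open>C^k\<close> says that \<open>x \<mapsto> Df(x)\<close> is \<open>C^k\<close>.\<close>

primrec Ck_on :: "nat \<Rightarrow> 'a::euclidean_space set \<Rightarrow> ('a \<Rightarrow> 'b::euclidean_space) \<Rightarrow> bool" where
  "Ck_on 0 S f \<longleftrightarrow> continuous_on S f"
| "Ck_on (Suc k) S f \<longleftrightarrow> (\<forall>x\<in>S. f differentiable (at x)) \<and>
     (\<forall>v. Ck_on k S (\<lambda>x. frechet_derivative f (at x) v))"

definition smooth_on :: "'a::euclidean_space set \<Rightarrow> ('a \<Rightarrow> 'b::euclidean_space) \<Rightarrow> bool" where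
  "smooth_on S f \<longleftrightarrow> (\<forall>k. Ck_on k S f)"

subsection \<open>Immersed submanifolds of a Euclidean space\<close>

text \<open>An immersed submanifold is a subset \<open>N\<close> with its own topology, possibly finer than the
  subspace topology, and a smooth structure for which the inclusion is an immersion. It is
  represented by the topology \<open>T\<close>, with \<open>N = topspace T\<close>. The smooth structure is
  determined by \<open>T\<close>: the maps below are the inverses of charts, and since each is an immersion
  into the ambient space, two of them with overlapping images are smoothly compatible.

  In place of \<open>\<real>^k\<close>, which cannot be a type when \<open>k\<close> varies, the parameter space is a
  \<open>k\<close>-dimensional linear subspace \<open>V\<close> of the ambient space. The parameter domain is the
  relatively open set \<open>W \<inter> V\<close>; smooth maps on it are exactly the restrictions of smooth maps on
  open \<open>W\<close> (extend by composing with the orthogonal projection to \<open>V\<close>).\<close>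

definition local_parametrization ::
  "'a::euclidean_space topology \<Rightarrow> 'a set \<Rightarrow> 'a set \<Rightarrow> ('a \<Rightarrow> 'a) \<Rightarrow> bool" where
  "local_parametrization T V W \<phi> \<longleftrightarrow>
     subspace V \<and> open W \<and> smooth_on W \<phi> \<and>
     (\<forall>x\<in>W \<inter> V. inj_on (frechet_derivative \<phi> (at x)) V) \<and>
     openin T (\<phi> ` (W \<inter> V)) \<and>
     homeomorphic_map (top_of_set (W \<inter> V)) (subtopology T (\<phi> ` (W \<inter> V))) \<phi>"

definition immersed_submanifold :: "nat \<Rightarrow> 'a::euclidean_space topology \<Rightarrow> bool" where
  "immersed_submanifold k T \<longleftrightarrow>
     Hausdorff_space T \<and> second_countable T \<and>
     (\<forall>p\<in>topspace T. \<exists>V W \<phi>. local_parametrization T V W \<phi> \<and> dim V = k \<and> p \<in> \<phi> ` (W \<inter> V))"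

text \<open>All parametrizations around \<open>p\<close> yield the same space.\<close>

definition tangent_space :: "'a::euclidean_space topology \<Rightarrow> 'a \<Rightarrow> 'a set" where
  "tangent_space T p =
     {w. \<exists>V W \<phi> x. local_parametrization T V W \<phi> \<and> x \<in> W \<inter> V \<and> \<phi> x = p \<and>
           w \<in> frechet_derivative \<phi> (at x) ` V}"

text \<open>A possibly singular distribution is given by its fibers. The dimension of the submanifold may
  depend on the point it passes through.\<close>

definition integrable_distribution :: "('a::euclidean_space \<Rightarrow> 'a set) \<Rightarrow> bool" where
  "integrable_distribution D \<longleftrightarrow>
     (\<forall>x. \<exists>k T. immersed_submanifold k T \<and> x \<in> topspace T \<and>
        (\<forall>p\<in>topspace T. tangent_space T p = D p))"

subsection \<open>Almost Poisson brackets\<close>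

definition almost_poisson_bracket ::
  "(('a::euclidean_space \<Rightarrow> real) \<Rightarrow> ('a \<Rightarrow> real) \<Rightarrow> 'a \<Rightarrow> real) \<Rightarrow> bool" where
  "almost_poisson_bracket B \<longleftrightarrow>
     (\<forall>f g. smooth_on UNIV f \<longrightarrow> smooth_on UNIV g \<longrightarrow>
        smooth_on UNIV (B f g) \<and> (\<forall>x. B f g x = - B g f x)) \<and>
     (\<forall>f g h. smooth_on UNIV f \<longrightarrow> smooth_on UNIV g \<longrightarrow> smooth_on UNIV h \<longrightarrow>
        (\<forall>a b x. B (\<lambda>y. a * f y + b * g y) h x = a * B f h x + b * B g h x) \<and>
        (\<forall>x. B (\<lambda>y. f y * g y) h x = f x * B g h x + B f h x * g x))"

text \<open>\<open>X\<close> is the vector field \<open>X\<^sub>f\<close> with \<open>X\<^sub>f(g) = {g, f}\<close>. Taking for \<open>g\<close> the coordinate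
  functions shows that \<open>X\<close> is unique, and smooth if \<open>B\<close> preserves smoothness.\<close>

definition hamiltonian_vector_field ::
  "(('a::euclidean_space \<Rightarrow> real) \<Rightarrow> ('a \<Rightarrow> real) \<Rightarrow> 'a \<Rightarrow> real) \<Rightarrow> ('a \<Rightarrow> real) \<Rightarrow> ('a \<Rightarrow> 'a) \<Rightarrow> bool"
  where
  "hamiltonian_vector_field B f X \<longleftrightarrow>
     (\<forall>g. smooth_on UNIV g \<longrightarrow> (\<forall>x. frechet_derivative g (at x) (X x) = B g f x))"

definition characteristic_distribution ::
  "(('a::euclidean_space \<Rightarrow> real) \<Rightarrow> ('a \<Rightarrow> real) \<Rightarrow> 'a \<Rightarrow> real) \<Rightarrow> 'a \<Rightarrow> 'a set" where
  "characteristic_distribution B x =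
     span {X x | f X. smooth_on UNIV f \<and> hamiltonian_vector_field B f X}"

subsection \<open>The bracket\<close>

unbundle cross3_syntax

definition grad :: "(real^3 \<Rightarrow> real) \<Rightarrow> real^3 \<Rightarrow> real^3" where
  "grad f x = (\<chi> i. frechet_derivative f (at x) (axis i 1))"

definition diag3 :: "real \<Rightarrow> real \<Rightarrow> real \<Rightarrow> real^3^3" where
  "diag3 a b c = (\<chi> i j. if i = j then vector [a, b, c] $ i else 0)"

definition angular_velocity :: "real \<Rightarrow> real \<Rightarrow> real^3^3 \<Rightarrow> real^3 \<Rightarrow> real^3" where
  "angular_velocity m r \<I> K = matrix_inv (\<I> + (m * r\<^sup>2) *\<^sub>R mat 1) *v K"

text \<open>Points of the phase space are pairs \<open>(\<gamma>, K)\<close>, and \<open>\<times>\<close> on vectors is the cross product.\<close>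

definition rank3_bracket ::
  "real \<Rightarrow> real \<Rightarrow> real^3^3 \<Rightarrow>
   ((real^3) \<times> (real^3) \<Rightarrow> real) \<Rightarrow> ((real^3) \<times> (real^3) \<Rightarrow> real) \<Rightarrow> (real^3) \<times> (real^3) \<Rightarrow> real" where
  "rank3_bracket m r \<I> f g = (\<lambda>(\<gamma>, K).
     let \<Omega> = angular_velocity m r \<I> K;
         f\<^sub>\<gamma> = grad (\<lambda>\<gamma>'. f (\<gamma>', K)) \<gamma>; f\<^sub>K = grad (\<lambda>K'. f (\<gamma>, K')) K;
         g\<^sub>\<gamma> = grad (\<lambda>\<gamma>'. g (\<gamma>', K)) \<gamma>; g\<^sub>K = grad (\<lambda>K'. g (\<gamma>, K')) K
     in - ((K + (m * r\<^sup>2) *\<^sub>R \<Omega>) \<bullet> (f\<^sub>K \<times> g\<^sub>K)) - \<gamma> \<bullet> ((f\<^sub>K \<times> g\<^sub>\<gamma>) - (g\<^sub>K \<times> f\<^sub>\<gamma>)))"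

subsection \<open>It is an almost Poisson bracket\<close>

lemma Ck_Suc: "Ck_on (Suc k) UNIV f \<Longrightarrow> Ck_on k UNIV f"
proof (induction k arbitrary: f)
  case 0
  then show ?case
    by (auto simp: continuous_on_eq_continuous_at differentiable_imp_continuous_within)
next
  case (Suc k)
  from Suc.prems have d: "f differentiable (at x)" for x by simp
  from Suc.prems have "Ck_on (Suc k) UNIV (\<lambda>x. frechet_derivative f (at x) v)" for v
    by (metis Ck_on.simps(2))
  then show ?case using d Suc.IH by (subst Ck_on.simps) blast
qed

lemma Ck_const: "Ck_on k UNIV (\<lambda>x. c)"
  by (induction k arbitrary: c) auto

lemma Ck_add: "Ck_on k UNIV f \<Longrightarrow> Ck_on k UNIV g \<Longrightarrow> Ck_on k UNIV (\<lambda>x. f x + g x)"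
proof (induction k arbitrary: f g)
  case 0 then show ?case by (auto intro: continuous_intros)
next
  case (Suc k)
  have e: "frechet_derivative (\<lambda>x. f x + g x) (at x) = (\<lambda>v. frechet_derivative f (at x) v + frechet_derivative g (at x) v)" for x
    using Suc.prems
    by (intro frechet_derivative_at[symmetric] has_derivative_add) (auto simp: frechet_derivative_works)
  show ?case unfolding Ck_on.simps e using Suc by auto
qed

lemma Ck_mult: fixes f g :: "'a::euclidean_space \<Rightarrow> real"
  shows "Ck_on k UNIV f \<Longrightarrow> Ck_on k UNIV g \<Longrightarrow> Ck_on k UNIV (\<lambda>x. f x * g x)"
proof (induction k arbitrary: f g)
  case 0 then show ?case by (auto intro: continuous_intros)
next
  case (Suc k)
  have e: "frechet_derivative (\<lambda>x. f x * g x) (at x) = (\<lambda>v. f x * frechet_derivative g (at x) v + frechet_derivative f (at x) v * g x)" for x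
    using Suc.prems
    by (intro frechet_derivative_at[symmetric] has_derivative_mult) (auto simp: frechet_derivative_works)
  show ?case unfolding Ck_on.simps e
    using Suc.prems Suc.IH Ck_Suc[OF Suc.prems(1)] Ck_Suc[OF Suc.prems(2)]
    by (auto intro!: Ck_add simp: differentiable_mult)
qed

lemma smooth_const: "smooth_on UNIV (\<lambda>x. c)" by (simp add: smooth_on_def Ck_const)
lemma smooth_add: "smooth_on UNIV f \<Longrightarrow> smooth_on UNIV g \<Longrightarrow> smooth_on UNIV (\<lambda>x. f x + g x)" by (simp add: smooth_on_def Ck_add)
lemma smooth_mult: fixes f g :: "'a::euclidean_space \<Rightarrow> real" shows "smooth_on UNIV f \<Longrightarrow> smooth_on UNIV g \<Longrightarrow> smooth_on UNIV (\<lambda>x. f x * g x)" by (simp add: smooth_on_def Ck_mult)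
lemma smooth_uminus: fixes f :: "'a::euclidean_space \<Rightarrow> real" shows "smooth_on UNIV f \<Longrightarrow> smooth_on UNIV (\<lambda>x. - f x)" using smooth_mult[OF smooth_const[of "-1"]] by auto
lemma smooth_diff: fixes f g :: "'a::euclidean_space \<Rightarrow> real" shows "smooth_on UNIV f \<Longrightarrow> smooth_on UNIV g \<Longrightarrow> smooth_on UNIV (\<lambda>x. f x - g x)"
  using smooth_add[OF _ smooth_uminus, of f g] by simp
lemma smooth_lin: assumes "bounded_linear f" shows "smooth_on UNIV f"
proof -
  have d: "frechet_derivative f (at x) = f" for x
    using assms by (metis bounded_linear_imp_has_derivative frechet_derivative_at)
  have "Ck_on k UNIV f" for k
    by (cases k) (auto simp: d Ck_const assms bounded_linear_imp_differentiable linear_continuous_on)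
  then show ?thesis by (simp add: smooth_on_def)
qed
lemma smooth_deriv: "smooth_on UNIV f \<Longrightarrow> smooth_on UNIV (\<lambda>x. frechet_derivative f (at x) v)"
  unfolding smooth_on_def using Ck_on.simps(2) by blast
lemma smooth_differentiable: "smooth_on UNIV f \<Longrightarrow> f differentiable (at x)"
  unfolding smooth_on_def using Ck_on.simps(2) by blast

lemma grad_fst: assumes "f differentiable (at (g, K))"
  shows "grad (\<lambda>y. f (y, K)) g $ i = frechet_derivative f (at (g, K)) (axis i 1, 0)"
proof -
  have "((\<lambda>y. f (y, K)) has_derivative (\<lambda>h. frechet_derivative f (at (g,K)) (h, 0))) (at g)"
    using assms by (intro has_derivative_compose[where f="\<lambda>y. (y,K)" and g=f])
      (auto intro!: derivative_eq_intros simp: frechet_derivative_works)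
  then show ?thesis unfolding grad_def by (metis (no_types, lifting) frechet_derivative_at vec_lambda_beta)
qed
lemma grad_snd: assumes "f differentiable (at (g, K))"
  shows "grad (\<lambda>y. f (g, y)) K $ i = frechet_derivative f (at (g, K)) (0, axis i 1)"
proof -
  have "((\<lambda>y. f (g,y)) has_derivative (\<lambda>h. frechet_derivative f (at (g,K)) (0,h))) (at K)"
    using assms by (intro has_derivative_compose[where f="\<lambda>y. (g,y)" and g=f])
      (auto intro!: derivative_eq_intros simp: frechet_derivative_works)
  then show ?thesis unfolding grad_def by (metis (no_types, lifting) frechet_derivative_at vec_lambda_beta)
qed

lemma rank3_bracket_expand: assumes "smooth_on UNIV f" "smooth_on UNIV g"
  shows "rank3_bracket m r \<I> f g = (\<lambda>x. let dg = (\<lambda>f i. frechet_derivative f (at x) (axis i 1, 0)); dK = (\<lambda>f i. frechet_derivative f (at x) (0, axis i 1));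
    A = (\<lambda>i. (snd x + (m * r\<^sup>2) *\<^sub>R angular_velocity m r \<I> (snd x)) $ i); c = (\<lambda>i. fst x $ i);
    q = (\<lambda>a b w. (w (1::3)) * (a (2::3) * b (3::3) - a 3 * b 2) + w 2 * (a 3 * b 1 - a 1 * b 3) + w 3 * (a 1 * b 2 - a 2 * b 1)) in
    - q (dK f) (dK g) A - (q (dK f) (dg g) c - q (dK g) (dg f) c :: real))"
  unfolding rank3_bracket_def
  by (auto simp: fun_eq_iff Let_def cross3_def inner_vec_def sum_3 vector_def grad_fst grad_snd smooth_differentiable[OF assms(1)] smooth_differentiable[OF assms(2)] algebra_simps)

theorem almost_poisson_bracket_rank3_bracket: "almost_poisson_bracket (rank3_bracket m r \<I>)"
proof -
  have A: "smooth_on UNIV (\<lambda>x::(real^3)\<times>(real^3). (snd x + (m * r\<^sup>2) *\<^sub>R angular_velocity m r \<I> (snd x)) $ i)" for i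
    unfolding angular_velocity_def 
    by (rule smooth_lin) (intro bounded_linear_compose[OF bounded_linear_vec_nth] bounded_linear_add bounded_linear_snd
      bounded_linear_compose[OF bounded_linear_scaleR_right] bounded_linear_compose[OF matrix_vector_mul_bounded_linear])
  have C: "smooth_on UNIV (\<lambda>x::(real^3)\<times>(real^3). fst x $ i)" for i
    by (rule smooth_lin) (intro bounded_linear_compose[OF bounded_linear_vec_nth] bounded_linear_fst)
  have lin: "frechet_derivative (\<lambda>y. a * f y + b * g y) (at x) = (\<lambda>v. a * frechet_derivative f (at x) v + b * frechet_derivative g (at x) v)"
     if "smooth_on UNIV f" "smooth_on UNIV g" for a b :: real and f g x
    by (intro frechet_derivative_at[symmetric] has_derivative_add has_derivative_mult_right) (auto simp: frechet_derivative_works[symmetric] smooth_differentiable that)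
  have mu: "frechet_derivative (\<lambda>y. f y * g y) (at x) = (\<lambda>v. f x * frechet_derivative g (at x) v + frechet_derivative f (at x) v * g x)"
     if "smooth_on UNIV f" "smooth_on UNIV g" for f g :: "_ \<Rightarrow> real" and x
    by (intro frechet_derivative_at[symmetric] has_derivative_mult) (auto simp: frechet_derivative_works[symmetric] smooth_differentiable that)
  show ?thesis unfolding almost_poisson_bracket_def
  proof (intro conjI allI impI)
    fix f g :: "(real^3)\<times>(real^3) \<Rightarrow> real" assume s: "smooth_on UNIV f" "smooth_on UNIV g"
    show "smooth_on UNIV (rank3_bracket m r \<I> f g)"
      unfolding rank3_bracket_expand[OF s] Let_def by (intro smooth_diff smooth_uminus smooth_add smooth_mult A C smooth_deriv s)
    show "rank3_bracket m r \<I> f g x = - rank3_bracket m r \<I> g f x" for x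
      unfolding rank3_bracket_expand[OF s] rank3_bracket_expand[OF s(2,1)] Let_def by (simp add: algebra_simps)
  next
    fix f g h :: "(real^3)\<times>(real^3) \<Rightarrow> real" and a b :: real and x assume s: "smooth_on UNIV f" "smooth_on UNIV g" "smooth_on UNIV h"
    show "rank3_bracket m r \<I> (\<lambda>y. a * f y + b * g y) h x = a * rank3_bracket m r \<I> f h x + b * rank3_bracket m r \<I> g h x"
      unfolding rank3_bracket_expand[OF s(1,3)] rank3_bracket_expand[OF s(2,3)] rank3_bracket_expand[OF smooth_add[OF smooth_mult[OF smooth_const s(1)] smooth_mult[OF smooth_const s(2)]] s(3)] Let_def lin[OF s(1,2)] by algebra
    show "rank3_bracket m r \<I> (\<lambda>y. f y * g y) h x = f x * rank3_bracket m r \<I> g h x + rank3_bracket m r \<I> f h x * g x"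
      unfolding rank3_bracket_expand[OF s(1,3)] rank3_bracket_expand[OF s(2,3)] rank3_bracket_expand[OF smooth_mult[OF s(1,2)] s(3)] Let_def mu[OF s(1,2)] by algebra
  qed
qed

end

theory Submission
  imports Defs
begin

text \<open>Every almost Hamiltonian vector field is annihilated by the 1-form
  \<open>\<alpha> = (K + m r\<^sup>2 \<Omega>) \<cdot> d\<gamma> + \<gamma> \<cdot> dK\<close>. If the characteristic distribution were
  integrable, \<open>\<alpha>\<close> and hence \<open>d\<alpha>\<close> would pull back to zero on every integral manifold, so
  \<open>d\<alpha>\<close> would vanish on each fiber. But the fiber over \<open>(\<gamma>, K) = (e\<^sub>1, 0)\<close> contains
  \<open>(e\<^sub>3, 0)\<close> and \<open>(0, e\<^sub>3)\<close>, on which \<open>d\<alpha>\<close> is, up to sign, \<open>m r\<^sup>2 / (m r\<^sup>2 + I\<^sub>3) \<noteq> 0\<close>.\<close>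

section \<open>Symmetry of second derivatives\<close>

text \<open>Two applications of the mean value theorem: along \<open>u\<close> to the increment of
  \<open>f\<close> over \<open>h *\<^sub>R v\<close>, then along \<open>v\<close> to
  \<open>\<lambda>z. f' z u\<close>. The second difference on the left is symmetric in
  \<open>u\<close> and \<open>v\<close>, so it can be compared with its counterpart for the other
  order of differentiation.\<close>

lemma mixed_difference_quotient:
  fixes f :: "'a::real_normed_vector \<Rightarrow> real" and u v x :: 'a
  assumes f: "\<And>y. y \<in> W \<Longrightarrow> (f has_derivative f' y) (at y)"
    and fu: "\<And>y. y \<in> W \<Longrightarrow> ((\<lambda>z. f' z u) has_derivative f'' y) (at y)"
    and W: "\<And>s t. 0 \<le> s \<Longrightarrow> s \<le> h \<Longrightarrow> 0 \<le> t \<Longrightarrow> t \<le> h \<Longrightarrow> x + s *\<^sub>R u + t *\<^sub>R v \<in> W"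
    and h: "0 < h"
  shows "\<exists>s t. 0 \<le> s \<and> s \<le> h \<and> 0 \<le> t \<and> t \<le> h \<and>
    f (x + h *\<^sub>R u + h *\<^sub>R v) - f (x + h *\<^sub>R u) - f (x + h *\<^sub>R v) + f x
      = h * (h * f'' (x + s *\<^sub>R u + t *\<^sub>R v) v)"
proof -
  define a where "a s = f (x + s *\<^sub>R u + h *\<^sub>R v) - f (x + s *\<^sub>R u)" for s
  have lin: "linear (f' y)" "linear (f'' y)" if "y \<in> W" for y
    using f[OF that] fu[OF that] by (auto dest: has_derivative_linear)
  have da: "(a has_real_derivative f' (x + s *\<^sub>R u + h *\<^sub>R v) u - f' (x + s *\<^sub>R u) u) (at s)"
    if s: "0 \<le> s" "s \<le> h" for s
  proof -
    have 1: "x + s *\<^sub>R u + h *\<^sub>R v \<in> W" "x + s *\<^sub>R u \<in> W"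
      using W[of s h] W[of s 0] s h by auto
    have l: "((\<lambda>s. x + s *\<^sub>R u + h *\<^sub>R v) has_derivative (\<lambda>d. d *\<^sub>R u)) (at s)"
      "((\<lambda>s. x + s *\<^sub>R u) has_derivative (\<lambda>d. d *\<^sub>R u)) (at s)"
      by (auto intro!: derivative_eq_intros)
    have "((\<lambda>s. f (x + s *\<^sub>R u + h *\<^sub>R v)) has_derivative (\<lambda>d. f' (x + s *\<^sub>R u + h *\<^sub>R v) (d *\<^sub>R u))) (at s)"
      using has_derivative_compose[OF l(1) f[OF 1(1)]] .
    moreover have "((\<lambda>s. f (x + s *\<^sub>R u)) has_derivative (\<lambda>d. f' (x + s *\<^sub>R u) (d *\<^sub>R u))) (at s)"
      using has_derivative_compose[OF l(2) f[OF 1(2)]] .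
    ultimately show ?thesis
      unfolding a_def has_field_derivative_def using lin(1)[OF 1(1)] lin(1)[OF 1(2)]
      by (auto intro!: has_derivative_eq_rhs[OF has_derivative_diff] simp: linear_scale fun_eq_iff algebra_simps)
  qed
  obtain s where s: "0 < s" "s < h"
    "a h - a 0 = (h - 0) * (f' (x + s *\<^sub>R u + h *\<^sub>R v) u - f' (x + s *\<^sub>R u) u)"
    using MVT2[OF h, of a "\<lambda>s. f' (x + s *\<^sub>R u + h *\<^sub>R v) u - f' (x + s *\<^sub>R u) u"] da by auto
  have db: "((\<lambda>t. f' (x + s *\<^sub>R u + t *\<^sub>R v) u) has_real_derivative f'' (x + s *\<^sub>R u + t *\<^sub>R v) v) (at t)"
    if t: "0 \<le> t" "t \<le> h" for t
  proof -
    have 1: "x + s *\<^sub>R u + t *\<^sub>R v \<in> W"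
      using W[of s t] s t by auto
    have l: "((\<lambda>t. x + s *\<^sub>R u + t *\<^sub>R v) has_derivative (\<lambda>d. d *\<^sub>R v)) (at t)"
      by (auto intro!: derivative_eq_intros)
    have "((\<lambda>t. f' (x + s *\<^sub>R u + t *\<^sub>R v) u) has_derivative (\<lambda>d. f'' (x + s *\<^sub>R u + t *\<^sub>R v) (d *\<^sub>R v))) (at t)"
      using has_derivative_compose[OF l fu[OF 1]] .
    then show ?thesis
      unfolding has_field_derivative_def using lin(2)[OF 1]
      by (auto elim!: has_derivative_eq_rhs simp: linear_scale fun_eq_iff algebra_simps)
  qed
  obtain t where t: "0 < t" "t < h"
    "f' (x + s *\<^sub>R u + h *\<^sub>R v) u - f' (x + s *\<^sub>R u + 0 *\<^sub>R v) u = (h - 0) * f'' (x + s *\<^sub>R u + t *\<^sub>R v) v"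
    using MVT2[OF h, of "\<lambda>t. f' (x + s *\<^sub>R u + t *\<^sub>R v) u" "\<lambda>t. f'' (x + s *\<^sub>R u + t *\<^sub>R v) v"] db by blast
  have "a h - a 0 = h * (h * f'' (x + s *\<^sub>R u + t *\<^sub>R v) v)"
    using s(3) t(3) by simp
  then show ?thesis
    using s t unfolding a_def by (intro exI[of _ s] exI[of _ t]) (auto simp: algebra_simps)
qed

text \<open>Evaluating the second difference in both orders shows that the two mixed derivatives
  agree at some pair of points of a small parallelogram at \<open>x\<close>. Continuity carries this
  over to \<open>x\<close>.\<close>

lemma mixed_derivatives_commute_real:
  fixes f :: "'a::real_normed_vector \<Rightarrow> real"
  assumes "open W" and "x \<in> W"
    and f: "\<And>y. y \<in> W \<Longrightarrow> (f has_derivative f' y) (at y)"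
    and fu: "\<And>y. y \<in> W \<Longrightarrow> ((\<lambda>z. f' z u) has_derivative fu' y) (at y)"
    and fv: "\<And>y. y \<in> W \<Longrightarrow> ((\<lambda>z. f' z v) has_derivative fv' y) (at y)"
    and cu: "continuous_on W (\<lambda>y. fu' y v)" and cv: "continuous_on W (\<lambda>y. fv' y u)"
  shows "fu' x v = fv' x u"
proof (rule ccontr)
  \<comment> \<open>Half of the supposed gap: one number cannot lie strictly within \<open>e\<close>
    of both values.\<close>
  define e where "e = \<bar>fu' x v - fv' x u\<bar> / 2"
  assume "fu' x v \<noteq> fv' x u"
  then have e: "e > 0" by (simp add: e_def)
  have "isCont (\<lambda>y. fu' y v) x" "isCont (\<lambda>y. fv' y u) x"
    using assms by (auto simp: continuous_on_eq_continuous_at)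
  then obtain d1 d2 where d: "d1 > 0" "d2 > 0"
    "\<And>y. dist y x < d1 \<Longrightarrow> dist (fu' y v) (fu' x v) < e"
    "\<And>y. dist y x < d2 \<Longrightarrow> dist (fv' y u) (fv' x u) < e"
    unfolding continuous_at_eps_delta using e by metis
  obtain d3 where d3: "d3 > 0" "ball x d3 \<subseteq> W"
    using assms(1,2) openE by blast
  define d where "d = min d1 (min d2 d3)"
  \<comment> \<open>The parallelogram spanned by \<open>h *\<^sub>R u\<close> and
    \<open>h *\<^sub>R v\<close> at \<open>x\<close> then stays within distance \<open>d\<close> of
    \<open>x\<close>; the summand 1 covers \<open>u = v = 0\<close>.\<close>
  define h where "h = d / (2 * (norm u + norm v + 1))"
  have n: "norm u + norm v + 1 > 0" by (simp add: add_nonneg_pos)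
  have "d > 0" using d(1,2) d3(1) by (simp add: d_def)
  then have h: "h > 0" using n by (simp add: h_def)
  have hn: "h * (norm u + norm v) < d"
  proof -
    have "h * (norm u + norm v) \<le> h * (norm u + norm v + 1)" using h by simp
    also have "\<dots> = d / 2" using n by (simp add: h_def field_simps)
    finally show ?thesis using \<open>d > 0\<close> by simp
  qed
  have near: "dist (x + s *\<^sub>R u + t *\<^sub>R v) x < d"
    if "0 \<le> s" "s \<le> h" "0 \<le> t" "t \<le> h" for s t
  proof -
    have "dist (x + s *\<^sub>R u + t *\<^sub>R v) x = norm (s *\<^sub>R u + t *\<^sub>R v)"
      by (simp add: dist_norm algebra_simps)
    also have "\<dots> \<le> s * norm u + t * norm v"
      using norm_triangle_ineq[of "s *\<^sub>R u" "t *\<^sub>R v"] that by simp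
    also have "\<dots> \<le> h * norm u + h * norm v"
      using that by (intro add_mono mult_right_mono) auto
    finally show ?thesis using hn by (simp add: algebra_simps)
  qed
  have inW: "x + s *\<^sub>R u + t *\<^sub>R v \<in> W" if "0 \<le> s" "s \<le> h" "0 \<le> t" "t \<le> h" for s t
    using near[OF that] d3 by (auto simp: d_def dist_commute)
  have inW': "x + s *\<^sub>R v + t *\<^sub>R u \<in> W" if "0 \<le> s" "s \<le> h" "0 \<le> t" "t \<le> h" for s t
    using inW[OF that(3,4,1,2)] by (simp add: algebra_simps)
  obtain s t where st: "0 \<le> s" "s \<le> h" "0 \<le> t" "t \<le> h"
    "f (x + h *\<^sub>R u + h *\<^sub>R v) - f (x + h *\<^sub>R u) - f (x + h *\<^sub>R v) + f x
      = h * (h * fu' (x + s *\<^sub>R u + t *\<^sub>R v) v)"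
    using mixed_difference_quotient[of W f f' u fu' h x v] f fu inW h by blast
  obtain s' t' where st': "0 \<le> s'" "s' \<le> h" "0 \<le> t'" "t' \<le> h"
    "f (x + h *\<^sub>R v + h *\<^sub>R u) - f (x + h *\<^sub>R v) - f (x + h *\<^sub>R u) + f x
      = h * (h * fv' (x + s' *\<^sub>R v + t' *\<^sub>R u) u)"
    using mixed_difference_quotient[of W f f' v fv' h x u] f fv inW' h by blast
  have "f (x + h *\<^sub>R v + h *\<^sub>R u) = f (x + h *\<^sub>R u + h *\<^sub>R v)"
    by (simp add: algebra_simps)
  then have eq: "fu' (x + s *\<^sub>R u + t *\<^sub>R v) v = fv' (x + t' *\<^sub>R u + s' *\<^sub>R v) u"
    using st(5) st'(5) h by (simp add: algebra_simps)
  have "dist (fu' (x + s *\<^sub>R u + t *\<^sub>R v) v) (fu' x v) < e"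
    by (rule d(3)) (use near[OF st(1-4)] in \<open>simp add: d_def\<close>)
  moreover have "dist (fv' (x + t' *\<^sub>R u + s' *\<^sub>R v) u) (fv' x u) < e"
    by (rule d(4)) (use near[OF st'(3,4,1,2)] in \<open>simp add: d_def\<close>)
  ultimately show False
    unfolding eq e_def
    using dist_triangle_half_r[of _ "fu' x v" "2 * e" "fv' x u"] by (simp add: dist_real_def e_def)
qed

text \<open>Pairing with the basis vectors reduces the claim to real-valued functions.\<close>

lemma mixed_derivatives_commute:
  fixes \<phi> :: "'a::euclidean_space \<Rightarrow> 'b::euclidean_space"
  assumes W: "open W" "x \<in> W" and smooth: "smooth_on W \<phi>"
  shows "frechet_derivative (\<lambda>y. frechet_derivative \<phi> (at y) u) (at x) v =
    frechet_derivative (\<lambda>y. frechet_derivative \<phi> (at y) v) (at x) u"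
proof (rule euclidean_eqI)
  fix b :: 'b
  let ?D = "\<lambda>w y. frechet_derivative \<phi> (at y) w"
  have C: "Ck_on (Suc (Suc 0)) W \<phi>"
    using smooth unfolding smooth_on_def by blast
  have D1: "(\<phi> has_derivative frechet_derivative \<phi> (at y)) (at y)" if "y \<in> W" for y
    using C that by (simp add: frechet_derivative_works)
  have D2: "(?D w has_derivative frechet_derivative (?D w) (at y)) (at y)" if "y \<in> W" for w y
    using C that by (simp add: frechet_derivative_works)
  have D3: "continuous_on W (\<lambda>y. frechet_derivative (?D w) (at y) w')" for w w'
    using C by simp
  show "frechet_derivative (?D u) (at x) v \<bullet> b = frechet_derivative (?D v) (at x) u \<bullet> b"
    by (rule mixed_derivatives_commute_real[OF W, where f = "\<lambda>y. \<phi> y \<bullet> b" and f' = "\<lambda>y w. ?D w y \<bullet> b"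
          and fu' = "\<lambda>y w. frechet_derivative (?D u) (at y) w \<bullet> b"
          and fv' = "\<lambda>y w. frechet_derivative (?D v) (at y) w \<bullet> b"])
      (auto intro!: has_derivative_inner_left D1 D2 continuous_on_inner D3 continuous_on_const)
qed

section \<open>Pullback of a 1-form to a parameter domain\<close>

text \<open>For constant coefficients \<open>\<beta>\<close>, the exterior derivative of the 1-form \<open>q \<mapsto> \<beta> q\<close> is
  \<open>(X, Y) \<mapsto> \<beta> X Y - \<beta> Y X\<close>.\<close>

lemma pullback_isotropic:
  fixes \<phi> :: "'a::euclidean_space \<Rightarrow> 'b::euclidean_space" and \<beta> :: "'b \<Rightarrow> 'b \<Rightarrow> real"
  assumes "bounded_bilinear \<beta>" and V: "subspace V" and W: "open W" and smooth: "smooth_on W \<phi>"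
    and ker: "\<And>y u. y \<in> W \<inter> V \<Longrightarrow> u \<in> V \<Longrightarrow> \<beta> (\<phi> y) (frechet_derivative \<phi> (at y) u) = 0"
    and x: "x \<in> W \<inter> V" and uv: "u \<in> V" "v \<in> V"
  shows "\<beta> (frechet_derivative \<phi> (at x) v) (frechet_derivative \<phi> (at x) u) =
    \<beta> (frechet_derivative \<phi> (at x) u) (frechet_derivative \<phi> (at x) v)"
proof -
  interpret bounded_bilinear \<beta> by fact
  let ?D = "\<lambda>w y. frechet_derivative \<phi> (at y) w"
  have C: "Ck_on (Suc (Suc 0)) W \<phi>"
    using smooth unfolding smooth_on_def by blast
  have D1: "(\<phi> has_derivative frechet_derivative \<phi> (at x)) (at x)"
    using C x by (simp add: frechet_derivative_works)
  have D2: "(?D w has_derivative frechet_derivative (?D w) (at x)) (at x)" for w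
    using C x by (simp add: frechet_derivative_works)
  \<comment> \<open>The product rule applied to \<open>ker\<close>, differentiated in the direction
    \<open>v\<close>.\<close>
  have *: "\<beta> (\<phi> x) (frechet_derivative (?D u) (at x) v) + \<beta> (?D v x) (?D u x) = 0"
    if uv: "u \<in> V" "v \<in> V" for u v
  proof -
    \<comment> \<open>\<open>ker\<close> is given on \<open>W \<inter> V\<close> only, which need
      not be open. The line through \<open>x\<close> in direction \<open>v\<close> stays in
      \<open>V\<close>, so the derivative is taken along it.\<close>
    have l: "((\<lambda>t::real. x + t *\<^sub>R v) has_derivative (\<lambda>t. t *\<^sub>R v)) (at 0)"
      by (auto intro!: derivative_eq_intros)
    have "((\<lambda>y. \<beta> (\<phi> y) (?D u y)) has_derivative
        (\<lambda>w. \<beta> (\<phi> x) (frechet_derivative (?D u) (at x) w) + \<beta> (?D w x) (?D u x))) (at x)"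
      by (rule FDERIV[OF D1 D2])
    then have d: "((\<lambda>t. \<beta> (\<phi> (x + t *\<^sub>R v)) (?D u (x + t *\<^sub>R v))) has_derivative
        (\<lambda>t. \<beta> (\<phi> x) (frechet_derivative (?D u) (at x) (t *\<^sub>R v)) + \<beta> (?D (t *\<^sub>R v) x) (?D u x))) (at 0)"
      using has_derivative_compose[OF l, of "\<lambda>y. \<beta> (\<phi> y) (?D u y)"] by simp
    have "open {t. x + t *\<^sub>R v \<in> W}"
      using open_vimage[OF W, of "\<lambda>t. x + t *\<^sub>R v"] by (simp add: vimage_def continuous_intros)
    moreover have "\<beta> (\<phi> (x + t *\<^sub>R v)) (?D u (x + t *\<^sub>R v)) = 0" if "x + t *\<^sub>R v \<in> W" for t
      using ker[of "x + t *\<^sub>R v" u] that x uv V by (auto intro!: subspace_add subspace_scale)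
    ultimately have "((\<lambda>t. 0) has_derivative
        (\<lambda>t. \<beta> (\<phi> x) (frechet_derivative (?D u) (at x) (t *\<^sub>R v)) + \<beta> (?D (t *\<^sub>R v) x) (?D u x))) (at 0)"
      using x by (intro has_derivative_transform_within_open[OF d]) auto
    then have "(\<lambda>t::real. \<beta> (\<phi> x) (frechet_derivative (?D u) (at x) (t *\<^sub>R v)) + \<beta> (?D (t *\<^sub>R v) x) (?D u x)) = (\<lambda>t. 0)"
      by (rule has_derivative_unique) (rule has_derivative_const)
    from fun_cong[OF this, of 1] show ?thesis by simp
  qed
  \<comment> \<open>Hence the second-order term is the same in \<open>*\<close> for
    \<open>(u, v)\<close> and for \<open>(v, u)\<close>, and subtraction removes it.\<close>
  have "frechet_derivative (?D u) (at x) v = frechet_derivative (?D v) (at x) u"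
    using mixed_derivatives_commute[OF W _ smooth] x by blast
  then show ?thesis
    using *[OF uv] *[OF uv(2,1)] by simp
qed

section \<open>Independence of the tangent space from the parametrization\<close>

text \<open>The curve \<open>t \<mapsto> \<phi>1 (x1 + t v)\<close> lifts through \<open>\<phi>2\<close> to a curve \<open>g \<circ> c\<close> that is only known
  to be continuous. The lower bound \<open>C\<close> for \<open>D\<phi>2\<close> makes its difference quotients \<open>y\<close> bounded,
  so that \<open>D\<phi>2 y\<close> approximates the velocity \<open>w\<close>, which then lies in the closed set \<open>D\<phi>2 V2\<close>.\<close>

lemma local_parametrization_tangent_subset:
  fixes T :: "'a::euclidean_space topology"
  assumes P1: "local_parametrization T V1 W1 \<phi>1" and P2: "local_parametrization T V2 W2 \<phi>2"
    and x1: "x1 \<in> W1 \<inter> V1" and x2: "x2 \<in> W2 \<inter> V2" and eq: "\<phi>1 x1 = \<phi>2 x2"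
  shows "frechet_derivative \<phi>1 (at x1) ` V1 \<subseteq> frechet_derivative \<phi>2 (at x2) ` V2"
proof
  let ?D1 = "frechet_derivative \<phi>1 (at x1)" and ?D2 = "frechet_derivative \<phi>2 (at x2)"
  have P1': "subspace V1" "open W1" "smooth_on W1 \<phi>1"
      "homeomorphic_map (top_of_set (W1 \<inter> V1)) (subtopology T (\<phi>1 ` (W1 \<inter> V1))) \<phi>1"
    and P2': "subspace V2" "smooth_on W2 \<phi>2" "inj_on ?D2 V2" "openin T (\<phi>2 ` (W2 \<inter> V2))"
      "homeomorphic_map (top_of_set (W2 \<inter> V2)) (subtopology T (\<phi>2 ` (W2 \<inter> V2))) \<phi>2"
    using P1 P2 x2 unfolding local_parametrization_def by auto
  have D1: "(\<phi>1 has_derivative ?D1) (at x1)" and D2: "(\<phi>2 has_derivative ?D2) (at x2)"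
    using P1'(3) P2'(2) x1 x2 unfolding smooth_on_def
    by (metis Ck_on.simps(2) IntD1 frechet_derivative_works)+
  have bl: "bounded_linear ?D2" using D2 by (rule has_derivative_bounded_linear)
  have inj: "\<forall>y\<in>V2. ?D2 y = 0 \<longrightarrow> y = 0"
    using P2'(1,3) linear_0[OF bounded_linear.linear[OF bl]] subspace_0 by (metis inj_onD)
  obtain C where C: "C > 0" "\<And>y. y \<in> V2 \<Longrightarrow> C * norm y \<le> norm (?D2 y)"
    using injective_imp_isometric[OF closed_subspace[OF P2'(1)] P2'(1) bl inj] by blast
  have cl: "closed (?D2 ` V2)"
    using closed_injective_image_subspace[OF P2'(1) bl inj closed_subspace[OF P2'(1)]] .
  obtain g where g: "continuous_map (subtopology T (\<phi>2 ` (W2 \<inter> V2))) (top_of_set (W2 \<inter> V2)) g"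
    "\<And>y. y \<in> W2 \<inter> V2 \<Longrightarrow> g (\<phi>2 y) = y"
    using P2'(5) unfolding homeomorphic_map_maps homeomorphic_maps_def by auto
  fix w assume "w \<in> ?D1 ` V1"
  then obtain v where v: "v \<in> V1" and w: "w = ?D1 v" by blast
  define c where "c t = \<phi>1 (x1 + t *\<^sub>R v)" for t
  define A where "A = {t. x1 + t *\<^sub>R v \<in> W1}"
  have openA: "open A"
    using open_vimage[OF P1'(2), of "\<lambda>t. x1 + t *\<^sub>R v"]
    by (simp add: vimage_def A_def continuous_intros)
  have "continuous_map (top_of_set A) (top_of_set (W1 \<inter> V1)) (\<lambda>t. x1 + t *\<^sub>R v)"
    using x1 v P1'(1) by (auto intro!: continuous_intros subspace_add subspace_scale simp: A_def)
  moreover have "continuous_map (top_of_set (W1 \<inter> V1)) T \<phi>1"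
    using P1'(4) homeomorphic_imp_continuous_map continuous_map_in_subtopology by blast
  ultimately have cc: "continuous_map (top_of_set A) T c"
    unfolding c_def by (rule continuous_map_compose[unfolded o_def])
  \<comment> \<open>The times at which the curve lies in the image of \<open>\<phi>2\<close>.
    Openness of \<open>B\<close> rests on continuity of \<open>c\<close> into \<open>T\<close>: for
    the ambient topology, the curve could leave this image immediately, on another sheet of the
    submanifold.\<close>
  define B where "B = {t \<in> A. c t \<in> \<phi>2 ` (W2 \<inter> V2)}"
  have "openin (top_of_set A) B"
    using openin_continuous_map_preimage[OF cc P2'(4)] by (simp add: B_def)
  then have openB: "open B" using openA openin_open_trans by blast
  have "0 \<in> B" using x1 x2 eq by (auto simp: B_def A_def c_def)
  have "continuous_map (top_of_set B) (subtopology T (\<phi>2 ` (W2 \<inter> V2))) c"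
    using continuous_map_from_subtopology[OF cc, of B]
    by (auto simp: continuous_map_in_subtopology B_def subtopology_subtopology Int_absorb1)
  then have "continuous_map (top_of_set B) (top_of_set (W2 \<inter> V2)) (g \<circ> c)"
    using g(1) by (rule continuous_map_compose)
  then have gc: "continuous_on B (g \<circ> c)" by auto
  have cB: "g (c t) \<in> W2 \<inter> V2 \<and> \<phi>2 (g (c t)) = c t" if "t \<in> B" for t
    using that g(2) unfolding B_def by fastforce
  have gc0: "g (c 0) = x2" using g(2) x2 eq by (simp add: c_def)
  have "((g \<circ> c) \<longlongrightarrow> x2) (at 0)"
    using gc openB \<open>0 \<in> B\<close> gc0 by (auto simp: continuous_on_eq_continuous_at isCont_def o_def)
  then have lim: "\<forall>\<^sub>F t in at 0. dist (g (c t)) x2 < d" if "d > 0" for d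
    using that by (auto dest: tendstoD)
  have evB: "\<forall>\<^sub>F t in at 0. t \<in> B"
    using openB \<open>0 \<in> B\<close> eventually_at_topological by blast
  have "((\<lambda>t. x1 + t *\<^sub>R v) has_derivative (\<lambda>t. t *\<^sub>R v)) (at 0)"
    by (auto intro!: derivative_eq_intros)
  then have "(c has_derivative (\<lambda>t. ?D1 (t *\<^sub>R v))) (at 0)"
    unfolding c_def by (rule has_derivative_compose) (use D1 in simp)
  then have "(c has_vector_derivative w) (at 0)"
    unfolding has_vector_derivative_def w
    using linear_scale[OF has_derivative_linear[OF D1]] by simp
  then have "((\<lambda>t. norm (c t - c 0 - t *\<^sub>R w) / norm t) \<longlongrightarrow> 0) (at 0)"
    unfolding has_vector_derivative_def has_derivative_iff_norm by simp
  then have "((\<lambda>t. norm ((c t - c 0) /\<^sub>R t - w)) \<longlongrightarrow> 0) (at 0)"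
  proof (rule Lim_transform_eventually)
    have "norm (c t - c 0 - t *\<^sub>R w) / norm t = norm ((c t - c 0) /\<^sub>R t - w)" if "t \<noteq> 0" for t
    proof -
      have "(c t - c 0) /\<^sub>R t - w = (c t - c 0 - t *\<^sub>R w) /\<^sub>R t"
        using that by (simp add: scaleR_diff_right)
      then show ?thesis by (simp add: divide_inverse mult.commute)
    qed
    then show "\<forall>\<^sub>F t in at 0. norm (c t - c 0 - t *\<^sub>R w) / norm t = norm ((c t - c 0) /\<^sub>R t - w)"
      by (simp add: eventually_at_filter)
  qed
  then have dc: "((\<lambda>t. (c t - c 0) /\<^sub>R t) \<longlongrightarrow> w) (at 0)"
    by (simp add: tendsto_norm_zero_iff Lim_null[of _ w])
  have "\<exists>y\<in>?D2 ` V2. dist y w < \<epsilon>" if "\<epsilon> > 0" for \<epsilon>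
  proof -
    \<comment> \<open>The bound \<open>C / 2\<close> lets the linearization error be absorbed in the
      estimate of \<open>norm y\<close>; the other bound then makes \<open>e * norm y\<close> at
      most \<open>\<epsilon> / 2\<close>.\<close>
    define e where "e = min (C / 2) (\<epsilon> * C / (4 * (norm w + 1)))"
    have nw: "norm w + 1 > 0" by (simp add: add_nonneg_pos)
    have e: "e > 0" using C(1) that nw by (simp add: e_def)
    obtain d where d: "d > 0" "\<And>y. norm (y - x2) < d \<Longrightarrow>
        norm (\<phi>2 y - \<phi>2 x2 - ?D2 (y - x2)) \<le> e * norm (y - x2)"
      using D2 e unfolding has_derivative_at_alt by blast
    \<comment> \<open>The 1 bounds the difference quotient by \<open>norm w + 1\<close>; the
      \<open>\<epsilon> / 2\<close> is for the final triangle inequality.\<close>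
    have "\<forall>\<^sub>F t in at 0. dist ((c t - c 0) /\<^sub>R t) w < min 1 (\<epsilon> / 2)"
      using tendstoD[OF dc, of "min 1 (\<epsilon> / 2)"] that by simp
    moreover have "\<forall>\<^sub>F t in at (0::real). t \<noteq> 0"
      by (simp add: eventually_at_filter)
    ultimately have "\<forall>\<^sub>F t in at 0. dist ((c t - c 0) /\<^sub>R t) w < min 1 (\<epsilon> / 2) \<and>
        t \<noteq> 0 \<and> t \<in> B \<and> dist (g (c t)) x2 < d"
      using evB lim[OF d(1)] by eventually_elim auto
    then obtain t where t: "dist ((c t - c 0) /\<^sub>R t) w < min 1 (\<epsilon> / 2)"
        "t \<noteq> 0" "t \<in> B" "dist (g (c t)) x2 < d"
      using eventually_happens'[OF at_neq_bot] by blast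
    define y where "y = (g (c t) - x2) /\<^sub>R t"
    define q where "q = (c t - c 0) /\<^sub>R t"
    have yV: "y \<in> V2"
      using cB[OF t(3)] x2 P2'(1) by (auto simp: y_def intro!: subspace_scale subspace_diff)
    have "norm (c t - c 0 - ?D2 (g (c t) - x2)) \<le> e * norm (g (c t) - x2)"
      using d(2)[of "g (c t)"] t(4) cB[OF t(3)] eq by (simp add: dist_norm c_def)
    moreover have "q - ?D2 y = (c t - c 0 - ?D2 (g (c t) - x2)) /\<^sub>R t"
      unfolding q_def y_def linear_scale[OF bounded_linear.linear[OF bl]]
      by (simp add: scaleR_diff_right)
    ultimately have qy: "norm (q - ?D2 y) \<le> e * norm y"
      using t(2) by (simp add: y_def mult_left_mono mult.left_commute)
    have "norm q \<le> norm w + 1"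
      using t(1) norm_triangle_ineq2[of q w] by (simp add: q_def dist_norm)
    moreover have "C * norm y \<le> norm q + e * norm y"
      \<comment> \<open>From \<open>C * norm y \<le> norm (?D2 y)\<close> and the triangle
        inequality.\<close>
      using C(2)[OF yV] qy norm_triangle_ineq2[of "?D2 y" q] by (simp add: norm_minus_commute)
    moreover have "e * norm y \<le> C / 2 * norm y"
      unfolding e_def by (rule mult_right_mono[OF min.cobounded1 norm_ge_zero])
    ultimately have "C / 2 * norm y \<le> norm w + 1" by (simp add: field_simps)
    then have ny: "norm y \<le> 2 * (norm w + 1) / C" using C(1) by (simp add: field_simps)
    have "e * norm y \<le> \<epsilon> * C / (4 * (norm w + 1)) * (2 * (norm w + 1) / C)"
      using ny that C(1) nw unfolding e_def by (intro mult_mono min.cobounded2) auto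
    also have "\<dots> = \<epsilon> / 2"
    proof -
      have "\<epsilon> * C / (4 * N) * (2 * N / C) = \<epsilon> / 2" if "N > 0" for N
        using that C(1) by (simp add: field_simps)
      then show ?thesis using nw .
    qed
    finally have "norm (q - ?D2 y) \<le> \<epsilon> / 2" using qy by linarith
    then have "dist (?D2 y) w < \<epsilon>"
      using t(1) dist_triangle[of "?D2 y" w q] by (simp add: dist_norm norm_minus_commute q_def)
    then show ?thesis using yV by blast
  qed
  then show "w \<in> ?D2 ` V2"
    using cl closed_approachable by blast
qed

text \<open>The definition collects vectors from all parametrizations around the point; by the
  inclusion just proved, any single one already yields them all.\<close>

lemma tangent_space_parametrization:
  assumes "local_parametrization T V W \<phi>" and "x \<in> W \<inter> V"
  shows "tangent_space T (\<phi> x) = frechet_derivative \<phi> (at x) ` V"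
  using assms local_parametrization_tangent_subset unfolding tangent_space_def by blast

section \<open>A necessary condition for integrability\<close>

text \<open>In a parametrization of the integral manifold through \<open>p\<close>, the fibers of
  \<open>D\<close> are the images of the derivative, so \<open>ker\<close> says that the 1-form
  pulls back to zero.\<close>

lemma integral_manifold_isotropic:
  fixes \<beta> :: "'a::euclidean_space \<Rightarrow> 'a \<Rightarrow> real"
  assumes int: "integrable_distribution D" and \<beta>: "bounded_bilinear \<beta>"
    and ker: "\<And>q w. w \<in> D q \<Longrightarrow> \<beta> q w = 0"
    and X: "X \<in> D p" and Y: "Y \<in> D p"
  shows "\<beta> X Y = \<beta> Y X"
proof -
  obtain k T where T: "immersed_submanifold k T" "p \<in> topspace T"
    "\<And>q. q \<in> topspace T \<Longrightarrow> tangent_space T q = D q"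
    using int unfolding integrable_distribution_def by metis
  then obtain V W \<phi> x where P: "local_parametrization T V W \<phi>" and x: "x \<in> W \<inter> V" "\<phi> x = p"
    unfolding immersed_submanifold_def by (metis imageE)
  have top: "\<phi> y \<in> topspace T" if "y \<in> W \<inter> V" for y
    using P that openin_subset unfolding local_parametrization_def by blast
  have D: "D (\<phi> y) = frechet_derivative \<phi> (at y) ` V" if "y \<in> W \<inter> V" for y
    using T(3)[OF top[OF that]] tangent_space_parametrization[OF P that] by simp
  obtain u v where "u \<in> V" "v \<in> V" "X = frechet_derivative \<phi> (at x) v" "Y = frechet_derivative \<phi> (at x) u"
    using X Y D[OF x(1)] x(2) by auto
  then show ?thesis
    using pullback_isotropic[OF \<beta>, of V W \<phi> x u v] P x ker D
    unfolding local_parametrization_def by auto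
qed

section \<open>The 1-form annihilating the Hamiltonian vector fields\<close>

text \<open>This is \<alpha> at the point \<open>q\<close> on the tangent vector \<open>w\<close>.
  Its coefficients are linear in \<open>q\<close>, so it can serve as the bilinear map
  \<open>\<beta>\<close>.\<close>

definition rank3_form :: "real \<Rightarrow> real \<Rightarrow> real^3^3 \<Rightarrow> (real^3) \<times> (real^3) \<Rightarrow> (real^3) \<times> (real^3) \<Rightarrow> real" where
  "rank3_form m r \<I> q w =
     (snd q + (m * r\<^sup>2) *\<^sub>R angular_velocity m r \<I> (snd q)) \<bullet> fst w + fst q \<bullet> snd w"

lemma bounded_linear_angular_velocity: "bounded_linear (angular_velocity m r \<I>)"
  unfolding angular_velocity_def by (rule matrix_vector_mul_bounded_linear)

lemma bounded_bilinear_rank3_form: "bounded_bilinear (rank3_form m r \<I>)"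
proof -
  have "linear (angular_velocity m r \<I>)"
    by (rule bounded_linear.linear[OF bounded_linear_angular_velocity])
  then have "bilinear (rank3_form m r \<I>)"
    unfolding bilinear_def
    by (auto intro!: linearI simp: rank3_form_def linear_add linear_scale inner_add_left inner_add_right algebra_simps)
  then show ?thesis by (simp add: bilinear_conv_bounded_bilinear)
qed

lemma linear_eq_sum_axis:
  fixes h :: "real^'n \<Rightarrow> real"
  assumes "linear h"
  shows "h u = (\<Sum>i\<in>UNIV. u $ i * h (axis i 1))"
proof -
  have "h u = h (\<Sum>i\<in>UNIV. u $ i *\<^sub>R axis i 1)"
    by (simp add: basis_expansion flip: scalar_mult_eq_scaleR)
  also have "\<dots> = (\<Sum>i\<in>UNIV. u $ i * h (axis i 1))"
    by (simp add: linear_sum[OF assms] linear_scale[OF assms])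
  finally show ?thesis .
qed

lemma linear_pair_eq_sum_axis:
  fixes h :: "(real^'m) \<times> (real^'n) \<Rightarrow> real"
  assumes "linear h"
  shows "h (u, w) = (\<Sum>i\<in>UNIV. u $ i * h (axis i 1, 0)) + (\<Sum>i\<in>UNIV. w $ i * h (0, axis i 1))"
proof -
  have l: "linear (\<lambda>u. h (u, 0))" "linear (\<lambda>w. h (0, w))"
    using linear_compose[OF _ assms, of "\<lambda>u. (u, 0)"] linear_compose[OF _ assms, of "\<lambda>w. (0, w)"]
    by (auto simp: linear_iff o_def)
  have "h (u, w) = h (u, 0) + h (0, w)"
    using linear_add[OF assms, of "(u, 0)" "(0, w)"] by simp
  then show ?thesis
    using linear_eq_sum_axis[OF l(1), of u] linear_eq_sum_axis[OF l(2), of w] by simp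
qed

text \<open>Cyclic permutation of the triple products in {g, f} isolates the gradients of g; their
  cofactors are the two components of the field.\<close>

lemma hamiltonian_vector_field_rank3_bracket:
  assumes f: "smooth_on UNIV f"
  shows "hamiltonian_vector_field (rank3_bracket m r \<I>) f (\<lambda>x.
    let L = snd x + (m * r\<^sup>2) *\<^sub>R angular_velocity m r \<I> (snd x);
        f\<^sub>\<gamma> = grad (\<lambda>y. f (y, snd x)) (fst x); f\<^sub>K = grad (\<lambda>y. f (fst x, y)) (snd x)
    in (fst x \<times> f\<^sub>K, L \<times> f\<^sub>K + fst x \<times> f\<^sub>\<gamma>))"
  unfolding hamiltonian_vector_field_def
proof (intro allI impI)
  fix g :: "(real^3) \<times> (real^3) \<Rightarrow> real" and x :: "(real^3) \<times> (real^3)"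
  assume g: "smooth_on UNIV g"
  have "linear (frechet_derivative g (at x))"
    using smooth_differentiable[OF g] by (rule linear_frechet_derivative)
  then show "frechet_derivative g (at x) (let L = snd x + (m * r\<^sup>2) *\<^sub>R angular_velocity m r \<I> (snd x);
        f\<^sub>\<gamma> = grad (\<lambda>y. f (y, snd x)) (fst x); f\<^sub>K = grad (\<lambda>y. f (fst x, y)) (snd x)
    in (fst x \<times> f\<^sub>K, L \<times> f\<^sub>K + fst x \<times> f\<^sub>\<gamma>)) = rank3_bracket m r \<I> g f x"
    unfolding rank3_bracket_expand[OF g f] Let_def
    by (subst linear_pair_eq_sum_axis, assumption)
      (simp add: cross3_def sum_3 vector_def grad_fst grad_snd smooth_differentiable[OF f], algebra)
qed

lemma characteristic_distribution_rank3_bracket_mem: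
  "(\<gamma> \<times> a, (K + (m * r\<^sup>2) *\<^sub>R angular_velocity m r \<I> K) \<times> a + \<gamma> \<times> b)
    \<in> characteristic_distribution (rank3_bracket m r \<I>) (\<gamma>, K)"
proof -
  \<comment> \<open>A linear function has constant gradients, so \<open>b\<close> and
    \<open>a\<close> can be prescribed freely.\<close>
  define f where "f x = b \<bullet> fst x + a \<bullet> snd x" for x :: "(real^3) \<times> (real^3)"
  have f: "smooth_on UNIV f"
    unfolding f_def[abs_def] by (intro smooth_lin bounded_linear_add bounded_linear_inner_right_comp
        bounded_linear_fst bounded_linear_snd)
  have grad: "grad (\<lambda>y. c \<bullet> y + d) y = c" "grad (\<lambda>y. d + c \<bullet> y) y = c" for c y :: "real^3" and d
  proof -
    have "((\<lambda>y. c \<bullet> y + d) has_derivative (\<lambda>y. c \<bullet> y)) (at y)"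
      "((\<lambda>y. d + c \<bullet> y) has_derivative (\<lambda>y. c \<bullet> y)) (at y)"
      by (auto intro!: derivative_eq_intros)
    then show "grad (\<lambda>y. c \<bullet> y + d) y = c" "grad (\<lambda>y. d + c \<bullet> y) y = c"
      unfolding grad_def by (auto simp: frechet_derivative_at[symmetric] inner_axis vec_eq_iff)
  qed
  show ?thesis
    unfolding characteristic_distribution_def
    by (rule span_base, rule CollectI, rule exI[of _ f], rule exI, rule conjI[rotated],
        rule conjI[OF f hamiltonian_vector_field_rank3_bracket[OF f]]) (simp add: Let_def f_def grad)
qed

text \<open>With \<open>q\<close> frozen, \<alpha> is a linear function \<open>?h\<close> equal to
  its own derivative, so its value on the field of \<open>f\<close> is the bracket of
  \<open>?h\<close> with \<open>f\<close> at \<open>q\<close>. The gradients of \<open>?h\<close>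
  are K + m r^2 \<Omega> in \<gamma> and \<gamma> in K, for which the triple products
  cancel.\<close>

lemma rank3_form_characteristic_distribution:
  assumes "w \<in> characteristic_distribution (rank3_bracket m r \<I>) q"
  shows "rank3_form m r \<I> q w = 0"
proof -
  let ?h = "rank3_form m r \<I> q"
  have bl: "bounded_linear ?h"
    by (rule bounded_bilinear.bounded_linear_right[OF bounded_bilinear_rank3_form])
  have h: "smooth_on UNIV ?h" using bl by (rule smooth_lin)
  have d: "frechet_derivative ?h (at q) = ?h"
    using bl by (metis bounded_linear_imp_has_derivative frechet_derivative_at)
  have "?h (X q) = 0" if "smooth_on UNIV f" "hamiltonian_vector_field (rank3_bracket m r \<I>) f X" for f X
  proof -
    have "?h (X q) = rank3_bracket m r \<I> ?h f q"
      using that(2) h d unfolding hamiltonian_vector_field_def by metis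
    also have "\<dots> = 0"
      unfolding rank3_bracket_expand[OF h that(1)] Let_def d
      by (simp add: rank3_form_def inner_axis) algebra
    finally show ?thesis .
  qed
  moreover have "subspace {w. ?h w = 0}"
    using bounded_linear.linear[OF bl] by (auto simp: subspace_def linear_0 linear_add linear_scale)
  ultimately have "characteristic_distribution (rank3_bracket m r \<I>) q \<subseteq> {w. ?h w = 0}"
    unfolding characteristic_distribution_def by (intro span_minimal) auto
  then show ?thesis using assms by blast
qed

section \<open>The fiber over (e1, 0)\<close>

lemma angular_velocity_diag3_axis:
  assumes "m * r\<^sup>2 + I1 \<noteq> 0" "m * r\<^sup>2 + I2 \<noteq> 0" "m * r\<^sup>2 + I3 \<noteq> 0"
  shows "angular_velocity m r (diag3 I1 I2 I3) (axis 3 1) = (1 / (m * r\<^sup>2 + I3)) *\<^sub>R axis 3 1"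
proof -
  let ?M = "diag3 I1 I2 I3 + (m * r\<^sup>2) *\<^sub>R mat 1"
  have "det ?M = (m * r\<^sup>2 + I1) * (m * r\<^sup>2 + I2) * (m * r\<^sup>2 + I3)"
    by (simp add: det_3 diag3_def mat_def vector_3) algebra
  then have "invertible ?M" using assms by (simp add: invertible_det_nz)
  \<comment> \<open>\<open>matrix_inv\<close> is a choice, so invertibility is what makes it an
    actual inverse.\<close>
  then have "matrix_inv ?M ** ?M = mat 1"
    unfolding invertible_def matrix_inv_def by (rule someI2_ex) blast
  then have inv: "matrix_inv ?M *v (?M *v y) = y" for y
    by (simp add: matrix_vector_mul_assoc)
  have "?M *v axis 3 1 = (m * r\<^sup>2 + I3) *\<^sub>R axis 3 1"
    by (simp add: vec_eq_iff forall_3 matrix_vector_mult_def sum_3 diag3_def mat_def axis_def vector_3)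
  then have "(m * r\<^sup>2 + I3) *\<^sub>R (matrix_inv ?M *v axis 3 1) = axis 3 1"
    using inv[of "axis 3 1"] by (simp add: matrix_vector_mult_scaleR)
  then have "(1 / (m * r\<^sup>2 + I3)) *\<^sub>R ((m * r\<^sup>2 + I3) *\<^sub>R (matrix_inv ?M *v axis 3 1)) = (1 / (m * r\<^sup>2 + I3)) *\<^sub>R axis 3 1"
    by simp
  then show ?thesis
    using assms(3) by (simp add: angular_velocity_def)
qed

theorem proposition2p2:
  fixes m r I1 I2 I3 :: real
  assumes "m > 0" and "r > 0" and "I1 > 0" and "I2 > 0" and "I3 > 0"
  shows "\<not> integrable_distribution (characteristic_distribution (rank3_bracket m r (diag3 I1 I2 I3)))"
proof
  let ?\<I> = "diag3 I1 I2 I3" and ?e = "axis 3 1 :: real^3"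
  let ?D = "characteristic_distribution (rank3_bracket m r ?\<I>)"
  assume int: "integrable_distribution ?D"
  have c: "m * r\<^sup>2 > 0" using assms by simp
  have [simp]: "angular_velocity m r ?\<I> 0 = 0"
    using bounded_linear.linear[OF bounded_linear_angular_velocity] by (rule linear_0)
  have cross: "(axis 1 1 :: real^3) \<times> axis 2 1 = ?e"
    by (simp add: cross3_def vec_eq_iff forall_3 vector_3 axis_def)
  \<comment> \<open>Since K = 0 and \<Omega> = 0 here, the gradients \<open>a = axis 2 1\<close>,
    \<open>b = 0\<close> give \<open>(?e, 0)\<close>, and exchanging them gives
    \<open>(0, ?e)\<close>.\<close>
  have "(?e, 0) \<in> ?D (axis 1 1, 0)"
    using characteristic_distribution_rank3_bracket_mem[of "axis 1 1" "axis 2 1" 0 m r ?\<I> 0] by (simp add: cross)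
  moreover have "(0, ?e) \<in> ?D (axis 1 1, 0)"
    using characteristic_distribution_rank3_bracket_mem[of "axis 1 1" 0 0 m r ?\<I> "axis 2 1"] by (simp add: cross)
  ultimately have "rank3_form m r ?\<I> (?e, 0) (0, ?e) = rank3_form m r ?\<I> (0, ?e) (?e, 0)"
    using integral_manifold_isotropic[OF int bounded_bilinear_rank3_form]
      rank3_form_characteristic_distribution by blast
  moreover have "angular_velocity m r ?\<I> ?e = (1 / (m * r\<^sup>2 + I3)) *\<^sub>R ?e"
    using c assms by (intro angular_velocity_diag3_axis) linarith+
  \<comment> \<open>The left value is 1 and the right one is 1 plus this quotient: the exact part
    d(K \<bullet> \<gamma>) of \<alpha> contributes 1 to both, and only the \<Omega> term breaks the
    symmetry.\<close>
  ultimately have "m * r\<^sup>2 / (m * r\<^sup>2 + I3) = 0"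
    by (simp add: rank3_form_def inner_axis inner_add_left)
  then show False using c assms by auto
qed

end
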